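(* Let $n_0\in\mathbb{N}$, and let $\hat{\mathcal{A}},\hat{\mathcal{B}}\subset\mathbb{R}^{n_0}$ be finite sets of orbit representatives of exponent vectors, under the symmetric group $\mathcal{S}_{n_0}$ acting by permutation of coordinates. For $n\ge n_0$, consider the $\mathcal{S}_n$-invariant signomial $f_n$ in $n$ variables associated with $\hat{\mathcal{A}},\hat{\mathcal{B}}$ (see context), and denote by $V_n$ the number of variables in the symmetry-adapted relative entropy program of $f_n$ (see context). Let $$m=\max\{\mathrm{wt}(\alpha):\alpha\in\hat{\mathcal{A}}\cup\hat{\mathcal{B}}\}.$$ Then, for every $n\ge 2m$, $V_n=V_{2m}$.
   Context: $\mathbb{N}=\{0,1,2,\dots\}$. $\mathcal{S}_n$ acts on $\mathbb{R}^n$ by $\sigma(x)=(x_{\sigma^{-1}(1)},\dots,x_{\sigma^{-1}(n)})$, both on variables and on exponent vectors. $\mathrm{wt}(\alpha)$ is the number of nonzero coordinates of $\alpha$. That $\hat{\mathcal{A}}$ and $\hat{\mathcal{B}}$ are sets of orbit representatives means that distinct elements lie in distinct $\mathcal{S}_{n_0}$-orbits; the set $\mathcal{S}_{n_0}\cdot\hat{\mathcal{A}}$ is nonempty and disjoint from $\mathcal{S}_{n_0}\cdot\hat{\mathcal{B}}$. The signomials $f_n$. Each $\alpha\in\hat{\mathcal{A}}\cup\hat{\mathcal{B}}$ comes with a coefficient $c_\alpha$, with $c_\alpha>0$ for $\alpha\in\hat{\mathcal{A}}$ and $c_\alpha<0$ for $\alpha\in\hat{\mathcal{B}}$. For $n\ge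 n_0$, each $\alpha\in\hat{\mathcal{A}}\cup\hat{\mathcal{B}}$ is regarded as a vector in $\mathbb{R}^n$ by adding $n-n_0$ zero coordinates. Then $f_n$ is the unique $\mathcal{S}_n$-invariant signomial $f_n(x)=\sum_{\gamma\in\mathcal{A}_n\cup\mathcal{B}_n}c_\gamma e^{\langle\gamma,x\rangle}$ whose support consists of the $\mathcal{S}_n$-orbits $\mathcal{A}_n=\mathcal{S}_n\cdot\hat{\mathcal{A}}$ and $\mathcal{B}_n=\mathcal{S}_n\cdot\hat{\mathcal{B}}$, with the corresponding coefficients (constant on orbits and equal to the given ones on the representatives). The signomials $f_n$, and hence the numbers $V_n$, are defined for $n\ge n_0$. The program and $V_n$. Let $\mathrm{Stab}(\beta)=\{\sigma\in\mathcal{S}_n:\sigma(\beta)=\beta\}$, and for a set $X$ acted on by a group $H$ let $X/H$ denote the set of $H$-orbits in $X$ (or representatives of them). The symmetry-adapted relative entropy program of $f_n$, which decides whether $f_n$ is a sum of nonnegative signomials supported on $\mathcal{A}\cup\mathcal{B}$ each having at most one negative coefficient, located at an element of $\mathcal{B}$ (here $G=\mathcal{S}_n$, $\mathcal{A}=\mathcal{A}_n$, $\mathcal{B}=\mathcal{B}_n$), has as variables the entries of vectors $c^{(\hat\beta)},\nu^{(\hat\beta)}\in\mathbb{R}_+^{\mathcal{A}/\mathrm{Stab}(\hat\beta)}$, one pair for each $\hat\beta\in\hat{\mathcal{B}}$, subject to $$\sum_{\alpha\in\mathcal{A}/\mathrm{Stab}(\hat\beta)}\nu^{(\hat\beta)}_\alpha\sum_{\alpha'\in\mathrm{Stab}(\hat\beta)\cdot\alpha}(\alpha'-\hat\beta)=0\quad(\hat\beta\in\hat{\mathcal{B}}),$$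 $$\sum_{\alpha\in\mathcal{A}/\mathrm{Stab}(\hat\beta)}|\mathrm{Stab}(\hat\beta)\cdot\alpha|\,\nu^{(\hat\beta)}_\alpha\ln\frac{\nu^{(\hat\beta)}_\alpha}{e\,c^{(\hat\beta)}_\alpha}\le c_{\hat\beta}\quad(\hat\beta\in\hat{\mathcal{B}}),$$ $$\sum_{\hat\beta\in\hat{\mathcal{B}}}\frac{|\mathrm{Stab}(\alpha)|}{|\mathrm{Stab}(\hat\beta)|}\sum_{\gamma\in(G\cdot\alpha)/\mathrm{Stab}(\hat\beta)}|\mathrm{Stab}(\hat\beta)\cdot\gamma|\,c^{(\hat\beta)}_\gamma\le c_\alpha\quad(\alpha\in\hat{\mathcal{A}}).$$ Thus $V_n=2\sum_{\hat\beta\in\hat{\mathcal{B}}}|\mathcal{A}_n/\mathrm{Stab}(\hat\beta)|$.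
   Formalization: Since V_n is defined only for n ≥ n_0, the value V_{2m} is undefined when 2m < n_0; the formal statement says V_n = V_{max(n_0,2m)} for all n ≥ max(n_0,2m), which is literally V_n = V_{2m} whenever 2m ≥ n_0. *)

theory Defs
  imports Complex_Main "HOL-Algebra.Group_Action" "HOL-Algebra.Sym_Groups"
begin

text \<open>
  Vectors are functions on the indices \<open>1, 2, \<dots>\<close>, and \<open>Rspace n\<close> is the copy of $n$-dimensional
  space consisting of those that vanish off \<open>{1..n}\<close>. Appending zero coordinates is thus the
  inclusion of \<open>Rspace n0\<close> in \<open>Rspace n\<close> and leaves the function unchanged.
\<close>

definition Rspace :: "nat \<Rightarrow> (nat \<Rightarrow> real) set" where
  "Rspace n = {x. \<forall>i. i \<notin> {1..n} \<longrightarrow> x i = 0}"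

definition perm_act :: "(nat \<Rightarrow> nat) \<Rightarrow> (nat \<Rightarrow> real) \<Rightarrow> nat \<Rightarrow> real" where
  "perm_act \<sigma> x = (\<lambda>i. x (Hilbert_Choice.inv \<sigma> i))"

definition wt :: "(nat \<Rightarrow> real) \<Rightarrow> nat" where
  "wt x = card {i. x i \<noteq> 0}"

abbreviation S_orbit :: "nat \<Rightarrow> (nat \<Rightarrow> real) \<Rightarrow> (nat \<Rightarrow> real) set" where
  "S_orbit n \<equiv> orbit (sym_group n) perm_act"

definition S_orbit_set :: "nat \<Rightarrow> (nat \<Rightarrow> real) set \<Rightarrow> (nat \<Rightarrow> real) set" where
  "S_orbit_set n X = (\<Union>\<alpha>\<in>X. S_orbit n \<alpha>)"

definition orbit_representatives :: "nat \<Rightarrow> (nat \<Rightarrow> real) set \<Rightarrow> bool" where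
  "orbit_representatives n X \<longleftrightarrow> inj_on (S_orbit n) X"

abbreviation Stab :: "nat \<Rightarrow> (nat \<Rightarrow> real) \<Rightarrow> (nat \<Rightarrow> nat) set" where
  "Stab n \<equiv> stabilizer (sym_group n) perm_act"

abbreviation Stab_group :: "nat \<Rightarrow> (nat \<Rightarrow> real) \<Rightarrow> (nat \<Rightarrow> nat) monoid" where
  "Stab_group n \<beta> \<equiv> (sym_group n) \<lparr>carrier := Stab n \<beta>\<rparr>"

text \<open>\<open>Stab_orbits n \<beta> X\<close> is the orbit set \<open>X / Stab(\<beta>)\<close>.\<close>

definition Stab_orbits ::
    "nat \<Rightarrow> (nat \<Rightarrow> real) \<Rightarrow> (nat \<Rightarrow> real) set \<Rightarrow> (nat \<Rightarrow> real) set set" where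
  "Stab_orbits n \<beta> X = orbits (Stab_group n \<beta>) X perm_act"

text \<open>
  A signomial \<open>\<Sum>\<gamma>. f \<gamma> * exp \<langle>\<gamma>, x\<rangle>\<close> is represented by its finitely supported coefficient
  function \<open>f\<close>; since distinct exponentials are linearly independent, the signomial and
  its coefficient function determine each other, and one is invariant
  under a permutation exactly if the other is.
\<close>

type_synonym signomial = "(nat \<Rightarrow> real) \<Rightarrow> real"

definition signomial_value :: "nat \<Rightarrow> signomial \<Rightarrow> (nat \<Rightarrow> real) \<Rightarrow> real" where
  "signomial_value n f x = (\<Sum>\<gamma> | f \<gamma> \<noteq> 0. f \<gamma> * exp (\<Sum>i=1..n. \<gamma> i * x i))"

definition is_sym_signomial ::
    "nat \<Rightarrow> (nat \<Rightarrow> real) set \<Rightarrow> (nat \<Rightarrow> real) set \<Rightarrow> ((nat \<Rightarrow> real) \<Rightarrow> real) \<Rightarrow> signomial \<Rightarrow> bool" where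
  "is_sym_signomial n A B c f \<longleftrightarrow>
     {\<gamma>. f \<gamma> \<noteq> 0} = S_orbit_set n A \<union> S_orbit_set n B \<and>
     (\<forall>\<sigma>\<in>carrier (sym_group n). \<forall>\<gamma>. f (perm_act \<sigma> \<gamma>) = f \<gamma>) \<and>
     (\<forall>\<alpha>\<in>A \<union> B. f \<alpha> = c \<alpha>)"

definition sym_signomial ::
    "nat \<Rightarrow> (nat \<Rightarrow> real) set \<Rightarrow> (nat \<Rightarrow> real) set \<Rightarrow> ((nat \<Rightarrow> real) \<Rightarrow> real) \<Rightarrow> signomial" where
  "sym_signomial n A B c = (THE f. is_sym_signomial n A B c f)"

text \<open>
  The symmetry-adapted relative entropy program. \<open>CVar \<beta> \<omega>\<close> and \<open>NuVar \<beta> \<omega>\<close> are the entries at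
  the orbit \<open>\<omega>\<close> of the vectors \<open>c\<close> and \<open>\<nu>\<close> belonging to \<open>\<beta>\<close>; entries are indexed by the orbits
  themselves rather than by chosen representatives.
\<close>

datatype sarep_var =
    CVar "nat \<Rightarrow> real" "(nat \<Rightarrow> real) set"
  | NuVar "nat \<Rightarrow> real" "(nat \<Rightarrow> real) set"

record 'v program =
  variables :: "'v set"
  feasible :: "('v \<Rightarrow> real) set"

definition sarep_variables ::
    "nat \<Rightarrow> (nat \<Rightarrow> real) set \<Rightarrow> (nat \<Rightarrow> real) set \<Rightarrow> sarep_var set" where
  "sarep_variables n A B =
     (\<Union>\<beta>\<in>B. \<Union>\<omega>\<in>Stab_orbits n \<beta> (S_orbit_set n A). {CVar \<beta> \<omega>, NuVar \<beta> \<omega>})"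

text \<open>
  In the entropy constraint the term \<open>\<nu> ln (\<nu> / (e c))\<close> is \<open>0\<close> if \<open>\<nu> = 0\<close> and \<open>\<infinity>\<close> if
  \<open>c = 0 < \<nu>\<close>; the latter is excluded by a separate condition because HOL has \<open>ln (\<nu> / 0) = 0\<close>.
\<close>

definition sarep ::
    "nat \<Rightarrow> (nat \<Rightarrow> real) set \<Rightarrow> (nat \<Rightarrow> real) set \<Rightarrow> signomial \<Rightarrow> sarep_var program" where
  "sarep n A B f =
     \<lparr>variables = sarep_variables n A B,
      feasible =
        {v \<in> sarep_variables n A B \<rightarrow>\<^sub>E {0..}.
          (\<forall>\<beta>\<in>B. \<forall>i\<in>{1..n}.
             (\<Sum>\<omega>\<in>Stab_orbits n \<beta> (S_orbit_set n A).
                v (NuVar \<beta> \<omega>) * (\<Sum>\<alpha>'\<in>\<omega>. \<alpha>' i - \<beta> i)) = 0) \<and>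
          (\<forall>\<beta>\<in>B. \<forall>\<omega>\<in>Stab_orbits n \<beta> (S_orbit_set n A).
             v (NuVar \<beta> \<omega>) > 0 \<longrightarrow> v (CVar \<beta> \<omega>) > 0) \<and>
          (\<forall>\<beta>\<in>B.
             (\<Sum>\<omega>\<in>Stab_orbits n \<beta> (S_orbit_set n A).
                real (card \<omega>) * v (NuVar \<beta> \<omega>)
                  * ln (v (NuVar \<beta> \<omega>) / (exp 1 * v (CVar \<beta> \<omega>)))) \<le> f \<beta>) \<and>
          (\<forall>\<alpha>\<in>A.
             (\<Sum>\<beta>\<in>B. real (card (Stab n \<alpha>)) / real (card (Stab n \<beta>))
                * (\<Sum>\<omega>\<in>Stab_orbits n \<beta> (S_orbit n \<alpha>). real (card \<omega>) * v (CVar \<beta> \<omega>))) \<le> f \<alpha>)}\<rparr>"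

definition num_variables ::
    "nat \<Rightarrow> (nat \<Rightarrow> real) set \<Rightarrow> (nat \<Rightarrow> real) set \<Rightarrow> ((nat \<Rightarrow> real) \<Rightarrow> real) \<Rightarrow> nat" where
  "num_variables n A B c = card (variables (sarep n A B (sym_signomial n A B c)))"


lemma finite_S_orbit: "finite (S_orbit n \<alpha>)"
proof -
  have "S_orbit n \<alpha> = (\<lambda>\<sigma>. perm_act \<sigma> \<alpha>) ` {\<sigma>. \<sigma> permutes {1..n}}"
    by (auto simp: orbit_def sym_group_carrier)
  then show ?thesis
    by (simp add: finite_permutations)
qed

lemma finite_Stab_orbits: "finite A \<Longrightarrow> finite (Stab_orbits n \<beta> (S_orbit_set n A))"
  by (auto simp: Stab_orbits_def orbits_def S_orbit_set_def setcompr_eq_image finite_S_orbit)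

lemma num_variables_eq:
  assumes "finite A" "finite B"
  shows "num_variables n A B c = 2 * (\<Sum>\<beta>\<in>B. card (Stab_orbits n \<beta> (S_orbit_set n A)))"
proof -
  let ?P = "SIGMA \<beta>:B. Stab_orbits n \<beta> (S_orbit_set n A)"
  have fin: "finite ?P"
    using assms by (simp add: finite_Stab_orbits)
  have "sarep_variables n A B = case_prod CVar ` ?P \<union> case_prod NuVar ` ?P"
    by (force simp: sarep_variables_def)
  moreover have "card (case_prod CVar ` ?P) = card ?P" "card (case_prod NuVar ` ?P) = card ?P"
    by (auto intro!: card_image simp: inj_on_def)
  moreover have "case_prod CVar ` ?P \<inter> case_prod NuVar ` ?P = {}"
    by auto
  ultimately have "card (sarep_variables n A B) = 2 * card ?P"
    using fin by (simp add: card_Un_disjoint)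
  then show ?thesis
    using assms by (simp add: num_variables_def sarep_def finite_Stab_orbits)
qed

lemma S_orbit_iff: "\<gamma> \<in> S_orbit n \<alpha> \<longleftrightarrow> (\<exists>\<sigma>. \<sigma> permutes {1..n} \<and> \<gamma> = (\<lambda>i. \<alpha> (\<sigma> i)))"
proof
  assume "\<gamma> \<in> S_orbit n \<alpha>"
  then show "\<exists>\<sigma>. \<sigma> permutes {1..n} \<and> \<gamma> = (\<lambda>i. \<alpha> (\<sigma> i))"
    by (auto simp: orbit_def sym_group_carrier perm_act_def intro: permutes_inv)
next
  assume "\<exists>\<sigma>. \<sigma> permutes {1..n} \<and> \<gamma> = (\<lambda>i. \<alpha> (\<sigma> i))"
  then obtain \<sigma> where \<sigma>: "\<sigma> permutes {1..n}" "\<gamma> = (\<lambda>i. \<alpha> (\<sigma> i))" by blast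
  then have "\<gamma> = perm_act (Hilbert_Choice.inv \<sigma>) \<alpha>"
    by (simp add: perm_act_def permutes_inv_inv)
  then show "\<gamma> \<in> S_orbit n \<alpha>"
    using \<sigma>(1) by (auto simp: orbit_def sym_group_carrier intro: permutes_inv)
qed

lemma S_orbit_refl: "\<alpha> \<in> S_orbit n \<alpha>"
  unfolding S_orbit_iff by (rule exI[of _ id]) (simp add: permutes_id)

lemma S_orbit_sym:
  assumes "\<gamma> \<in> S_orbit n \<alpha>"
  shows "\<alpha> \<in> S_orbit n \<gamma>"
proof -
  from assms obtain \<sigma> where \<sigma>: "\<sigma> permutes {1..n}" "\<gamma> = (\<lambda>i. \<alpha> (\<sigma> i))"
    by (auto simp: S_orbit_iff)
  then have "\<alpha> = (\<lambda>i. \<gamma> (Hilbert_Choice.inv \<sigma> i))"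
    by (simp add: permutes_inverses)
  then show ?thesis
    using \<sigma>(1) permutes_inv S_orbit_iff by blast
qed

lemma S_orbit_trans:
  assumes "\<gamma> \<in> S_orbit n \<beta>" "\<beta> \<in> S_orbit n \<alpha>"
  shows "\<gamma> \<in> S_orbit n \<alpha>"
proof -
  from assms obtain \<sigma> \<tau> where "\<sigma> permutes {1..n}" "\<tau> permutes {1..n}"
    "\<gamma> = (\<lambda>i. \<beta> (\<sigma> i))" "\<beta> = (\<lambda>i. \<alpha> (\<tau> i))"
    by (auto simp: S_orbit_iff)
  then have "\<tau> \<circ> \<sigma> permutes {1..n} \<and> \<gamma> = (\<lambda>i. \<alpha> ((\<tau> \<circ> \<sigma>) i))"
    by (simp add: permutes_compose)
  then show ?thesis
    unfolding S_orbit_iff by blast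
qed

lemma S_orbit_eqI: "\<gamma> \<in> S_orbit n \<alpha> \<Longrightarrow> S_orbit n \<gamma> = S_orbit n \<alpha>"
  by (auto intro: S_orbit_trans S_orbit_sym)

lemma S_orbit_padding:
  assumes "\<alpha> \<in> Rspace n0" "\<beta> \<in> Rspace n0" "n0 \<le> n" "\<beta> \<in> S_orbit n \<alpha>"
  shows "\<beta> \<in> S_orbit n0 \<alpha>"
proof -
  from assms(4) obtain \<sigma> where \<sigma>: "\<sigma> permutes {1..n}" "\<beta> = (\<lambda>i. \<alpha> (\<sigma> i))"
    by (auto simp: S_orbit_iff)
  have split: "image_mset x (mset_set {1..n}) =
      image_mset x (mset_set {1..n0}) + replicate_mset (n - n0) 0" if "x \<in> Rspace n0" for x
  proof -
    have "{1..n} = {1..n0} \<union> {Suc n0..n}" using assms(3) by auto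
    then have "mset_set {1..n} = mset_set {1..n0} + mset_set {Suc n0..n}"
      by (simp add: mset_set_Union)
    moreover have "image_mset x (mset_set {Suc n0..n}) = image_mset (\<lambda>_. 0) (mset_set {Suc n0..n})"
      using that by (intro image_mset_cong) (auto simp: Rspace_def)
    ultimately show ?thesis by (simp add: image_mset_const_eq)
  qed
  have "image_mset \<beta> (mset_set {1..n}) = image_mset \<alpha> (image_mset \<sigma> (mset_set {1..n}))"
    by (simp add: \<sigma>(2) multiset.map_comp comp_def)
  also have "image_mset \<sigma> (mset_set {1..n}) = mset_set {1..n}"
    using \<sigma>(1) by (simp add: image_mset_mset_set permutes_inj_on permutes_image)
  finally have "image_mset \<alpha> (mset_set {1..n0}) = image_mset \<beta> (mset_set {1..n0})"
    using split[OF assms(1)] split[OF assms(2)] by simp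
  from image_mset_eq_implies_permutes[OF _ this]
  obtain p where p: "p permutes {1..n0}" "\<forall>i\<in>{1..n0}. \<alpha> i = \<beta> (p i)" by auto
  have "\<alpha> = (\<lambda>i. \<beta> (p i))"
  proof
    fix i show "\<alpha> i = \<beta> (p i)"
      using p assms(1,2) by (cases "i \<in> {1..n0}") (auto simp: Rspace_def permutes_not_in)
  qed
  then show ?thesis
    using p(1) S_orbit_iff S_orbit_sym by blast
qed

text \<open>The description used to define \<open>sym_signomial\<close> determines exactly one signomial.\<close>

lemma ex1_sym_signomial:
  assumes "A \<subseteq> Rspace n0" "B \<subseteq> Rspace n0" "n0 \<le> n"
    and "orbit_representatives n0 A" "orbit_representatives n0 B"
    and "S_orbit_set n0 A \<inter> S_orbit_set n0 B = {}"
    and "\<And>\<alpha>. \<alpha> \<in> A \<union> B \<Longrightarrow> c \<alpha> \<noteq> 0"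
  shows "\<exists>!f. is_sym_signomial n A B c f"
proof -
  have uniq: "\<alpha> = \<beta>"
    if "\<alpha> \<in> A \<union> B" "\<beta> \<in> A \<union> B" "\<gamma> \<in> S_orbit n \<alpha>" "\<gamma> \<in> S_orbit n \<beta>" for \<alpha> \<beta> \<gamma>
  proof -
    have "\<beta> \<in> S_orbit n \<alpha>"
      using that S_orbit_sym S_orbit_trans by blast
    then have *: "\<beta> \<in> S_orbit n0 \<alpha>"
      using S_orbit_padding assms(1-3) that by blast
    then have **: "S_orbit n0 \<beta> = S_orbit n0 \<alpha>" by (rule S_orbit_eqI)
    have "\<not> (\<alpha> \<in> A \<and> \<beta> \<in> B)" "\<not> (\<alpha> \<in> B \<and> \<beta> \<in> A)"
      using assms(6) * S_orbit_refl by (fastforce simp: S_orbit_set_def)+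
    then show ?thesis
      using ** that(1,2) assms(4,5) unfolding orbit_representatives_def inj_on_def by blast
  qed
  have supp: "S_orbit_set n A \<union> S_orbit_set n B = (\<Union>\<alpha>\<in>A \<union> B. S_orbit n \<alpha>)"
    by (auto simp: S_orbit_set_def)
  have act: "perm_act \<sigma> \<gamma> \<in> S_orbit n \<gamma>" if "\<sigma> \<in> carrier (sym_group n)" for \<sigma> \<gamma>
    using that by (auto simp: orbit_def)
  have act_iff: "perm_act \<sigma> \<gamma> \<in> S_orbit n \<alpha> \<longleftrightarrow> \<gamma> \<in> S_orbit n \<alpha>"
    if "\<sigma> \<in> carrier (sym_group n)" for \<sigma> \<gamma> \<alpha>
    using act[OF that] S_orbit_sym S_orbit_trans by blast
  define f where
    "f \<gamma> = (if \<exists>\<alpha>\<in>A \<union> B. \<gamma> \<in> S_orbit n \<alpha> then c (THE \<alpha>. \<alpha> \<in> A \<union> B \<and> \<gamma> \<in> S_orbit n \<alpha>) else 0)"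
    for \<gamma>
  have f: "f \<gamma> = c \<alpha>" if "\<alpha> \<in> A \<union> B" "\<gamma> \<in> S_orbit n \<alpha>" for \<alpha> \<gamma>
  proof -
    have "(THE \<alpha>. \<alpha> \<in> A \<union> B \<and> \<gamma> \<in> S_orbit n \<alpha>) = \<alpha>"
      using that uniq by (intro the_equality) blast+
    then show ?thesis using that unfolding f_def by auto
  qed
  have f0: "f \<gamma> = 0" if "\<not> (\<exists>\<alpha>\<in>A \<union> B. \<gamma> \<in> S_orbit n \<alpha>)" for \<gamma>
    using that unfolding f_def by simp
  show ?thesis
  proof (rule ex1I)
    have "{\<gamma>. f \<gamma> \<noteq> 0} = (\<Union>\<alpha>\<in>A \<union> B. S_orbit n \<alpha>)"
    proof (rule Set.set_eqI)
      fix \<gamma>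
      show "\<gamma> \<in> {\<gamma>. f \<gamma> \<noteq> 0} \<longleftrightarrow> \<gamma> \<in> (\<Union>\<alpha>\<in>A \<union> B. S_orbit n \<alpha>)"
      proof (cases "\<exists>\<alpha>\<in>A \<union> B. \<gamma> \<in> S_orbit n \<alpha>")
        case True
        then obtain \<alpha> where \<alpha>: "\<alpha> \<in> A \<union> B" "\<gamma> \<in> S_orbit n \<alpha>" by blast
        then have "f \<gamma> \<noteq> 0" using f[OF \<alpha>] assms(7)[OF \<alpha>(1)] by simp
        then show ?thesis using \<alpha> by blast
      next
        case False
        then show ?thesis using f0[OF False] by blast
      qed
    qed
    moreover have "f (perm_act \<sigma> \<gamma>) = f \<gamma>" if "\<sigma> \<in> carrier (sym_group n)" for \<sigma> \<gamma>
      using act_iff[OF that] unfolding f_def by simp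
    moreover have "f \<alpha> = c \<alpha>" if "\<alpha> \<in> A \<union> B" for \<alpha>
      using f[OF that] S_orbit_refl by blast
    ultimately show "is_sym_signomial n A B c f"
      unfolding is_sym_signomial_def supp by blast
  next
    fix g assume g: "is_sym_signomial n A B c g"
    show "g = f"
    proof
      fix \<gamma>
      show "g \<gamma> = f \<gamma>"
      proof (cases "\<exists>\<alpha>\<in>A \<union> B. \<gamma> \<in> S_orbit n \<alpha>")
        case True
        then obtain \<alpha> where \<alpha>: "\<alpha> \<in> A \<union> B" "\<gamma> \<in> S_orbit n \<alpha>" by blast
        then obtain \<sigma> where "\<sigma> \<in> carrier (sym_group n)" "\<gamma> = perm_act \<sigma> \<alpha>"
          by (auto simp: orbit_def)
        then have "g \<gamma> = c \<alpha>"
          using g \<alpha>(1) by (simp add: is_sym_signomial_def)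
        then show ?thesis using f[OF \<alpha>] by simp
      next
        case False
        then have "\<gamma> \<notin> {\<gamma>. g \<gamma> \<noteq> 0}"
          using g unfolding is_sym_signomial_def supp by blast
        then show ?thesis using f0[OF False] by simp
      qed
    qed
  qed
qed

end

theory Submission
  imports Defs
begin

text \<open>
  Two vectors lie in the same \<open>Stab(\<beta>)\<close>-orbit exactly if, paired coordinatewise with \<open>\<beta>\<close>, they
  yield the same multiset of pairs. Passing from \<open>n\<close> to \<open>n + 1\<close> adds one pair \<open>(0, 0)\<close> to the
  multiset. No new multisets arise if \<open>n \<ge> 2m\<close>: the supports of \<open>\<beta>\<close> and \<open>\<gamma>\<close> together have at
  most \<open>2m\<close> elements, so a nonzero entry of \<open>\<gamma>\<close> at \<open>n + 1\<close> can be swapped with a common zero of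
  \<open>\<beta>\<close> and \<open>\<gamma>\<close> at an earlier place.
\<close>

definition joint_values :: "nat \<Rightarrow> (nat \<Rightarrow> real) \<Rightarrow> (nat \<Rightarrow> real) \<Rightarrow> (real \<times> real) multiset" where
  "joint_values n \<beta> \<gamma> = image_mset (\<lambda>i. (\<beta> i, \<gamma> i)) (mset_set {1..n})"

lemma Rspace_mono: "n \<le> k \<Longrightarrow> Rspace n \<subseteq> Rspace k"
  by (force simp: Rspace_def)

lemma joint_values_Suc:
  "joint_values (Suc n) \<beta> \<gamma> = add_mset (\<beta> (Suc n), \<gamma> (Suc n)) (joint_values n \<beta> \<gamma>)"
  by (simp add: joint_values_def atLeastAtMostSuc_conv)

text \<open>Permuting both vectors at once merely reindexes the pairs. If \<open>\<sigma>\<close>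
  also fixes \<open>\<beta>\<close>, this becomes invariance of the multiset under the
  stabilizer.\<close>

lemma joint_values_comp_permutes:
  assumes "\<sigma> permutes {1..n}"
  shows "joint_values n (\<lambda>i. \<beta> (\<sigma> i)) (\<lambda>i. \<gamma> (\<sigma> i)) = joint_values n \<beta> \<gamma>"
proof -
  have "joint_values n (\<lambda>i. \<beta> (\<sigma> i)) (\<lambda>i. \<gamma> (\<sigma> i)) =
      image_mset (\<lambda>i. (\<beta> i, \<gamma> i)) (image_mset \<sigma> (mset_set {1..n}))"
    by (simp add: joint_values_def multiset.map_comp comp_def)
  also have "image_mset \<sigma> (mset_set {1..n}) = mset_set {1..n}"
    using assms by (simp add: image_mset_mset_set permutes_inj_on permutes_image)
  finally show ?thesis by (simp add: joint_values_def)
qed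

text \<open>\<open>perm_act\<close> composes with the inverse permutation. A stabilizer is closed
  under inverses, so membership can be witnessed by plain composition.\<close>

lemma Stab_orbit_iff:
  "\<gamma>' \<in> orbit (Stab_group n \<beta>) perm_act \<gamma> \<longleftrightarrow>
    (\<exists>\<sigma>. \<sigma> permutes {1..n} \<and> (\<lambda>i. \<beta> (\<sigma> i)) = \<beta> \<and> \<gamma>' = (\<lambda>i. \<gamma> (\<sigma> i)))"
proof
  assume "\<gamma>' \<in> orbit (Stab_group n \<beta>) perm_act \<gamma>"
  then show "\<exists>\<sigma>. \<sigma> permutes {1..n} \<and> (\<lambda>i. \<beta> (\<sigma> i)) = \<beta> \<and> \<gamma>' = (\<lambda>i. \<gamma> (\<sigma> i))"
    by (auto simp: orbit_def stabilizer_def sym_group_carrier perm_act_def intro: permutes_inv)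
next
  assume "\<exists>\<sigma>. \<sigma> permutes {1..n} \<and> (\<lambda>i. \<beta> (\<sigma> i)) = \<beta> \<and> \<gamma>' = (\<lambda>i. \<gamma> (\<sigma> i))"
  then obtain \<sigma> where \<sigma>: "\<sigma> permutes {1..n}" "(\<lambda>i. \<beta> (\<sigma> i)) = \<beta>" "\<gamma>' = (\<lambda>i. \<gamma> (\<sigma> i))"
    by blast
  let ?\<tau> = "Hilbert_Choice.inv \<sigma>"
  have "?\<tau> permutes {1..n}" "perm_act ?\<tau> \<beta> = \<beta>" "\<gamma>' = perm_act ?\<tau> \<gamma>"
    using \<sigma> by (simp_all add: perm_act_def permutes_inv permutes_inv_inv)
  then show "\<gamma>' \<in> orbit (Stab_group n \<beta>) perm_act \<gamma>"
    unfolding orbit_def stabilizer_def sym_group_carrier by auto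
qed

text \<open>A permutation that matches equal multisets of pairs does two things: its first
  components say that it fixes \<open>\<beta>\<close>, its second components that it carries
  \<open>\<gamma>\<close> to \<open>\<gamma>'\<close>.\<close>

lemma Stab_orbit_eq:
  assumes "\<beta> \<in> Rspace n" "\<gamma> \<in> Rspace n"
  shows "orbit (Stab_group n \<beta>) perm_act \<gamma> =
    {\<gamma>' \<in> Rspace n. joint_values n \<beta> \<gamma>' = joint_values n \<beta> \<gamma>}"
proof (rule Set.set_eqI, rule iffI)
  fix \<gamma>' assume "\<gamma>' \<in> orbit (Stab_group n \<beta>) perm_act \<gamma>"
  then obtain \<sigma> where \<sigma>: "\<sigma> permutes {1..n}" "(\<lambda>i. \<beta> (\<sigma> i)) = \<beta>" "\<gamma>' = (\<lambda>i. \<gamma> (\<sigma> i))"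
    by (auto simp: Stab_orbit_iff)
  have "\<gamma>' \<in> Rspace n"
    using \<sigma>(1,3) assms(2) by (auto simp: Rspace_def permutes_not_in)
  then show "\<gamma>' \<in> {\<gamma>' \<in> Rspace n. joint_values n \<beta> \<gamma>' = joint_values n \<beta> \<gamma>}"
    using joint_values_comp_permutes[OF \<sigma>(1), of \<beta> \<gamma>] \<sigma>(2,3) by simp
next
  fix \<gamma>' assume "\<gamma>' \<in> {\<gamma>' \<in> Rspace n. joint_values n \<beta> \<gamma>' = joint_values n \<beta> \<gamma>}"
  then have \<gamma>': "\<gamma>' \<in> Rspace n"
    and "image_mset (\<lambda>i. (\<beta> i, \<gamma>' i)) (mset_set {1..n}) =
      image_mset (\<lambda>i. (\<beta> i, \<gamma> i)) (mset_set {1..n})"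
    by (auto simp: joint_values_def)
  from image_mset_eq_implies_permutes[OF _ this(2)]
  obtain p where p: "p permutes {1..n}" "\<forall>i\<in>{1..n}. (\<beta> i, \<gamma>' i) = (\<beta> (p i), \<gamma> (p i))"
    by auto
  \<comment> \<open>Off \<open>{1..n}\<close> all three vectors vanish and \<open>p\<close> is the
    identity, so the matching extends to every index.\<close>
  have "\<beta> i = \<beta> (p i) \<and> \<gamma>' i = \<gamma> (p i)" for i
    using p assms \<gamma>' by (cases "i \<in> {1..n}") (auto simp: Rspace_def permutes_not_in)
  then show "\<gamma>' \<in> orbit (Stab_group n \<beta>) perm_act \<gamma>"
    unfolding Stab_orbit_iff using p(1) by (intro exI[of _ p]) auto
qed

text \<open>Orbits are the fibres of \<open>joint_values n \<beta>\<close> in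
  \<open>Rspace n\<close>, so counting orbits amounts to counting attained values.\<close>

lemma card_Stab_orbits:
  assumes "\<beta> \<in> Rspace n" "X \<subseteq> Rspace n"
  shows "card (Stab_orbits n \<beta> X) = card (joint_values n \<beta> ` X)"
proof -
  let ?F = "\<lambda>M. {\<gamma>' \<in> Rspace n. joint_values n \<beta> \<gamma>' = M}"
  have "Stab_orbits n \<beta> X = (\<lambda>\<gamma>. orbit (Stab_group n \<beta>) perm_act \<gamma>) ` X"
    by (auto simp: Stab_orbits_def orbits_def)
  also have "\<dots> = ?F ` joint_values n \<beta> ` X"
    unfolding image_image using assms by (intro image_cong refl Stab_orbit_eq) auto
  finally have "Stab_orbits n \<beta> X = ?F ` joint_values n \<beta> ` X" .
  \<comment> \<open>Each value is attained on \<open>X\<close>, so its fibre is nonempty and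
    determines it.\<close>
  moreover have "inj_on ?F (joint_values n \<beta> ` X)"
    using assms(2) by (intro inj_onI) blast
  ultimately show ?thesis by (simp add: card_image)
qed

lemma S_orbit_mono:
  assumes "n \<le> k"
  shows "S_orbit n \<alpha> \<subseteq> S_orbit k \<alpha>"
proof
  fix \<gamma> assume "\<gamma> \<in> S_orbit n \<alpha>"
  then obtain \<sigma> where "\<sigma> permutes {1..n}" "\<gamma> = (\<lambda>i. \<alpha> (\<sigma> i))"
    by (auto simp: S_orbit_iff)
  moreover have "{1..n} \<subseteq> {1..k}" using assms by auto
  ultimately show "\<gamma> \<in> S_orbit k \<alpha>"
    unfolding S_orbit_iff using permutes_subset by blast
qed

lemma S_orbit_subset_Rspace: "\<alpha> \<in> Rspace n \<Longrightarrow> n \<le> k \<Longrightarrow> S_orbit k \<alpha> \<subseteq> Rspace k"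
  by (auto simp: S_orbit_iff Rspace_def permutes_not_in)

lemma wt_S_orbit:
  assumes "\<gamma> \<in> S_orbit n \<alpha>"
  shows "wt \<gamma> = wt \<alpha>"
proof -
  from assms obtain \<sigma> where \<sigma>: "\<sigma> permutes {1..n}" "\<gamma> = (\<lambda>i. \<alpha> (\<sigma> i))"
    by (auto simp: S_orbit_iff)
  then have "{i. \<gamma> i \<noteq> 0} = \<sigma> -` {i. \<alpha> i \<noteq> 0}" by auto
  then show ?thesis
    unfolding wt_def using card_vimage_inj[of \<sigma> "{i. \<alpha> i \<noteq> 0}"] \<sigma>(1)
    by (metis permutes_inj permutes_surj subset_UNIV)
qed

lemma finite_support: "x \<in> Rspace n \<Longrightarrow> finite {i. x i \<noteq> 0}"
  by (rule finite_subset[of _ "{1..n}"]) (auto simp: Rspace_def)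

lemma joint_values_image_Suc:
  assumes A: "A \<subseteq> Rspace n" and \<beta>: "\<beta> \<in> Rspace n"
    and wt: "\<And>\<alpha>. \<alpha> \<in> A \<Longrightarrow> wt \<alpha> + wt \<beta> \<le> n"
  shows "joint_values (Suc n) \<beta> ` S_orbit_set (Suc n) A =
    add_mset (0, 0) ` joint_values n \<beta> ` S_orbit_set n A"
proof (intro equalityI subsetI)
  fix M assume "M \<in> add_mset (0, 0) ` joint_values n \<beta> ` S_orbit_set n A"
  then obtain \<alpha> \<gamma> where \<gamma>: "\<alpha> \<in> A" "\<gamma> \<in> S_orbit n \<alpha>" "M = add_mset (0, 0) (joint_values n \<beta> \<gamma>)"
    by (auto simp: S_orbit_set_def)
  then have "\<gamma> \<in> Rspace n"
    using A S_orbit_subset_Rspace[of \<alpha> n n] by blast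
  then have "M = joint_values (Suc n) \<beta> \<gamma>"
    using \<beta> \<gamma>(3) by (simp add: joint_values_Suc Rspace_def)
  moreover have "\<gamma> \<in> S_orbit_set (Suc n) A"
    using \<gamma>(1,2) S_orbit_mono[of n "Suc n"] by (auto simp: S_orbit_set_def)
  ultimately show "M \<in> joint_values (Suc n) \<beta> ` S_orbit_set (Suc n) A" by blast
next
  fix M assume "M \<in> joint_values (Suc n) \<beta> ` S_orbit_set (Suc n) A"
  then obtain \<alpha> \<gamma> where \<gamma>: "\<alpha> \<in> A" "\<gamma> \<in> S_orbit (Suc n) \<alpha>" "M = joint_values (Suc n) \<beta> \<gamma>"
    by (auto simp: S_orbit_set_def)
  have \<alpha>: "\<alpha> \<in> Rspace n" using A \<gamma>(1) by blast
  then have \<gamma>R: "\<gamma> \<in> Rspace (Suc n)"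
    using \<gamma>(2) S_orbit_subset_Rspace[of \<alpha> n "Suc n"] by auto
  have \<beta>0: "\<beta> (Suc n) = 0" using \<beta> by (simp add: Rspace_def)
  \<comment> \<open>\<open>\<gamma>\<close> is replaced by a vector with the same multiset of pairs
    whose last coordinate is zero.\<close>
  obtain \<gamma>' where \<gamma>': "\<gamma>' \<in> S_orbit (Suc n) \<alpha>" "\<gamma>' (Suc n) = 0" "M = joint_values (Suc n) \<beta> \<gamma>'"
  proof -
    let ?U = "{i. \<gamma> i \<noteq> 0} \<union> {i. \<beta> i \<noteq> 0}"
    have "card ?U \<le> wt \<gamma> + wt \<beta>" by (simp add: wt_def card_Un_le)
    \<comment> \<open>The weights sum to at most \<open>n\<close>, one less than the number of
      places, so some place is a common zero.\<close>
    also have "\<dots> < card {1..Suc n}"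
      using wt[OF \<gamma>(1)] wt_S_orbit[OF \<gamma>(2)] by simp
    finally have "\<not> {1..Suc n} \<subseteq> ?U"
      using finite_support[OF \<gamma>R] finite_support[OF \<beta>] card_mono[of ?U "{1..Suc n}"] by auto
    then obtain j where j: "j \<in> {1..Suc n}" "\<gamma> j = 0" "\<beta> j = 0" by blast
    let ?t = "transpose j (Suc n)"
    let ?\<gamma>' = "\<lambda>i. \<gamma> (?t i)"
    have t: "?t permutes {1..Suc n}" using j(1) by (intro permutes_swap_id) auto
    \<comment> \<open>The transposition swaps two zeros of \<open>\<beta>\<close>, so it lies in the
      stabilizer; for \<open>j = Suc n\<close> it is the identity.\<close>
    have "(\<lambda>i. \<beta> (?t i)) = \<beta>" using \<beta>0 j(3) by (auto simp: transpose_def)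
    then have "M = joint_values (Suc n) \<beta> ?\<gamma>'"
      using joint_values_comp_permutes[OF t, of \<beta> \<gamma>] \<gamma>(3) by simp
    moreover have "?\<gamma>' \<in> S_orbit (Suc n) \<gamma>" unfolding S_orbit_iff using t by blast
    ultimately show ?thesis
      using that[of ?\<gamma>'] j(2) \<gamma>(2) S_orbit_trans by simp
  qed
  have "\<gamma>' \<in> Rspace (Suc n)"
    using \<gamma>'(1) \<alpha> S_orbit_subset_Rspace[of \<alpha> n "Suc n"] by auto
  then have "\<gamma>' i = 0" if "i \<notin> {1..n}" for i
    using \<gamma>'(2) that by (cases "i = Suc n") (auto simp: Rspace_def)
  then have "\<gamma>' \<in> Rspace n" by (simp add: Rspace_def)
  \<comment> \<open>The permutation relating \<open>\<gamma>'\<close> to \<open>\<alpha>\<close> may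
    move \<open>Suc n\<close>. As both vectors vanish there, one of \<open>{1..n}\<close> can be
    found instead.\<close>
  then have "\<gamma>' \<in> S_orbit n \<alpha>"
    using S_orbit_padding[OF \<alpha> _ _ \<gamma>'(1)] by simp
  then have "\<gamma>' \<in> S_orbit_set n A"
    using \<gamma>(1) by (auto simp: S_orbit_set_def)
  then show "M \<in> add_mset (0, 0) ` joint_values n \<beta> ` S_orbit_set n A"
    using \<gamma>'(2,3) \<beta>0 by (auto simp: joint_values_Suc)
qed

text \<open>Adding the fixed pair \<open>(0, 0)\<close> is injective on multisets, so equally many
  values are attained in both dimensions.\<close>

lemma card_Stab_orbits_Suc:
  assumes "A \<subseteq> Rspace n" "\<beta> \<in> Rspace n" "\<And>\<alpha>. \<alpha> \<in> A \<Longrightarrow> wt \<alpha> + wt \<beta> \<le> n"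
  shows "card (Stab_orbits (Suc n) \<beta> (S_orbit_set (Suc n) A)) =
    card (Stab_orbits n \<beta> (S_orbit_set n A))"
proof -
  have X: "S_orbit_set k A \<subseteq> Rspace k" if "n \<le> k" for k
    using assms(1) S_orbit_subset_Rspace[OF _ that] by (fastforce simp: S_orbit_set_def)
  have "card (Stab_orbits (Suc n) \<beta> (S_orbit_set (Suc n) A)) =
      card (add_mset (0, 0) ` joint_values n \<beta> ` S_orbit_set n A)"
    using assms X Rspace_mono[of n "Suc n"]
    by (subst card_Stab_orbits) (auto simp: joint_values_image_Suc)
  also have "\<dots> = card (joint_values n \<beta> ` S_orbit_set n A)"
    by (intro card_image inj_onI) simp
  also have "\<dots> = card (Stab_orbits n \<beta> (S_orbit_set n A))"
    using assms(2) X by (simp add: card_Stab_orbits)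
  finally show ?thesis .
qed

text \<open>The reference dimension is \<open>max n0 (2 * m)\<close> because the signomials are
  meant only from \<open>n0\<close> on; it equals \<open>2 * m\<close> whenever
  \<open>n0 \<le> 2 * m\<close>.\<close>

theorem theorem5p2:
  fixes n0 n m :: nat
    and Ahat Bhat :: "(nat \<Rightarrow> real) set"
    and c :: "(nat \<Rightarrow> real) \<Rightarrow> real"
  assumes "finite Ahat" and "finite Bhat"
    and "Ahat \<subseteq> Rspace n0" and "Bhat \<subseteq> Rspace n0"
    and "orbit_representatives n0 Ahat" and "orbit_representatives n0 Bhat"
    and "S_orbit_set n0 Ahat \<noteq> {}"
    and "S_orbit_set n0 Ahat \<inter> S_orbit_set n0 Bhat = {}"
    and "\<And>\<alpha>. \<alpha> \<in> Ahat \<Longrightarrow> c \<alpha> > 0"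
    and "\<And>\<beta>. \<beta> \<in> Bhat \<Longrightarrow> c \<beta> < 0"
    and "m = Max (wt ` (Ahat \<union> Bhat))"
    and "n \<ge> n0" and "n \<ge> 2 * m"
  shows "num_variables n Ahat Bhat c = num_variables (max n0 (2 * m)) Ahat Bhat c"
proof -
  have wt: "wt \<alpha> \<le> m" if "\<alpha> \<in> Ahat \<union> Bhat" for \<alpha>
    using that assms(1,2,11) by (auto intro!: Max_ge)
  have "max n0 (2 * m) \<le> n" using assms(12,13) by simp
  then show ?thesis
  proof (induction n rule: dec_induct)
    case (step k)
    \<comment> \<open>The number of variables is twice the sum of these orbit counts over
      \<open>Bhat\<close>, so each \<open>\<beta>\<close> can be treated separately. Here
      \<open>n0 \<le> k\<close> places the vectors in \<open>Rspace k\<close>, and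
      \<open>2 * m \<le> k\<close> bounds the two weights.\<close>
    have "card (Stab_orbits (Suc k) \<beta> (S_orbit_set (Suc k) Ahat)) =
        card (Stab_orbits k \<beta> (S_orbit_set k Ahat))" if "\<beta> \<in> Bhat" for \<beta>
    proof (rule card_Stab_orbits_Suc)
      show "Ahat \<subseteq> Rspace k" "\<beta> \<in> Rspace k"
        using that assms(3,4) Rspace_mono[of n0 k] step(1) by auto
      show "wt \<alpha> + wt \<beta> \<le> k" if "\<alpha> \<in> Ahat" for \<alpha>
        using wt[of \<alpha>] wt[of \<beta>] that \<open>\<beta> \<in> Bhat\<close> step(1) by simp
    qed
    then show ?case
      using step.IH assms(1,2) by (simp add: num_variables_eq)
  qed simp
qed

end
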